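(* Let $G$ be a finite group with irreducible characters $\chi_1,\dots,\chi_t$, and let $1\le i,j\le t$. Then for any integer $r\ge 1$, $$\sum_{\underline{g}\in G^{(r)}}\chi_i^{(r)}(\underline{g})\,\overline{\chi_j^{(r)}(\underline{g})}=\frac{r!\,|G|^r\,\delta_{ij}}{(\dim\chi_i)^{r-1}}(\dim\chi_i-1)\cdots(\dim\chi_i-(r-1)),$$ where the product $(\dim\chi_i-1)\cdots(\dim\chi_i-(r-1))$ is empty and equal to $1$ when $r=1$.
   Context: $\chi_1,\dots,\chi_t$ are the distinct irreducible complex characters of $G$, $\dim\chi_i=\chi_i(1)$, $\delta_{ij}$ is the Kronecker delta, and $G^{(r)}=G\times\cdots\times G$ ($r$ copies). Frobenius $r$-characters: for an irreducible character $\chi$ of $G$, put $\chi^{(1)}(g)=\chi(g)$, $\chi^{(2)}(g_1,g_2)=\chi(g_1)\chi(g_2)-\chi(g_1g_2)$, and for $r\ge 3$ define $\chi^{(r)}:G^{(r)}\to\mathbb{C}$ recursively by $$\chi^{(r)}(g_1,\dots,g_r)=\chi(g_1)\chi^{(r-1)}(g_2,\dots,g_r)-\chi^{(r-1)}(g_1g_2,g_3,\dots,g_r)-\chi^{(r-1)}(g_2,g_1g_3,\dots,g_r)-\cdots-\chi^{(r-1)}(g_2,\dots,g_1g_r).$$ *)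

theory Defs
  imports "Jordan_Normal_Form.VS_Connect"
begin

definition mat_trace :: "'a :: comm_monoid_add mat \<Rightarrow> 'a" where
  "mat_trace A = (\<Sum>i < dim_row A. A $$ (i, i))"

definition complex_representation ::
    "('g, 'm) monoid_scheme \<Rightarrow> nat \<Rightarrow> ('g \<Rightarrow> complex mat) \<Rightarrow> bool" where
  "complex_representation G n \<rho> \<longleftrightarrow> \<rho> \<in> hom G (units_of (ring_mat TYPE(complex) n ()))"

definition irreducible_representation ::
    "('g, 'm) monoid_scheme \<Rightarrow> nat \<Rightarrow> ('g \<Rightarrow> complex mat) \<Rightarrow> bool" where
  "irreducible_representation G n \<rho> \<longleftrightarrow>
     complex_representation G n \<rho> \<and> n > 0 \<and>
     (\<forall>W. subspace class_ring W (module_vec TYPE(complex) n) \<and>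
          (\<forall>g \<in> carrier G. \<forall>w \<in> W. \<rho> g *\<^sub>v w \<in> W)
          \<longrightarrow> W = {0\<^sub>v n} \<or> W = carrier_vec n)"

(* Characters are restricted to the carrier, so that HOL equality of two of them is
   equality of functions on G. *)
definition irreducible_characters :: "('g, 'm) monoid_scheme \<Rightarrow> ('g \<Rightarrow> complex) set" where
  "irreducible_characters G =
     {\<lambda>g \<in> carrier G. mat_trace (\<rho> g) | n \<rho>. irreducible_representation G n \<rho>}"

definition char_dim :: "('g, 'm) monoid_scheme \<Rightarrow> ('g \<Rightarrow> complex) \<Rightarrow> complex" where
  "char_dim G \<phi> = \<phi> \<one>\<^bsub>G\<^esub>"

(* The r-character; its argument (g_1, ..., g_r) is a list of length r. In the last
   equation g is g_1 and hs is the list (g_2, ..., g_r), whose entries are multiplied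
   by g_1 on the left one at a time; r = 2 is covered by the same equation.
   The value at the empty list is arbitrary. *)
function frobenius_char :: "('g, 'm) monoid_scheme \<Rightarrow> ('g \<Rightarrow> complex) \<Rightarrow> 'g list \<Rightarrow> complex" where
  "frobenius_char G \<phi> [] = 1"
| "frobenius_char G \<phi> [g] = \<phi> g"
| "frobenius_char G \<phi> (g # h # gs) =
     (let hs = h # gs in
        \<phi> g * frobenius_char G \<phi> hs
        - (\<Sum>k < length hs. frobenius_char G \<phi> (hs[k := g \<otimes>\<^bsub>G\<^esub> hs ! k])))"
  by pat_completeness auto
termination
  by (relation "measure (\<lambda>(_, _, gs). length gs)") (auto simp del: list_update.simps)

lemma frobenius_char_two:
  "frobenius_char G \<phi> [g, h] = \<phi> g * \<phi> h - \<phi> (g \<otimes>\<^bsub>G\<^esub> h)"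
  by simp

lemma frobenius_char_three:
  "frobenius_char G \<phi> [g, h, k] =
     \<phi> g * frobenius_char G \<phi> [h, k]
     - frobenius_char G \<phi> [g \<otimes>\<^bsub>G\<^esub> h, k] - frobenius_char G \<phi> [h, g \<otimes>\<^bsub>G\<^esub> k]"
  by (simp add: numeral_2_eq_2 lessThan_Suc)

definition group_tuples :: "('g, 'm) monoid_scheme \<Rightarrow> nat \<Rightarrow> 'g list set" where
  "group_tuples G r = {gs. set gs \<subseteq> carrier G \<and> length gs = r}"

end

(* If rho affords the character chi and has degree n, then chi^(r)(g_1, ..., g_r) is the sum, over
   all tuples f of r indices below n, of the determinant of the r x r matrix with (k, l) entry
   rho(g_k)_{f l, f k}: Laplace expansion along the first row and column of this matrix, summed over
   the index f 0, is the defining recursion. The conjugate of an r-character is the r-character of the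
   dual representation. Expanding both determinants over permutations p, q and summing over the g_k
   one at a time, Schur orthogonality kills everything for distinct characters. For equal ones it
   leaves (|G| / n)^r times the sum over f, p, q of sign p * sign q with f o p = f o q. For a
   given f this sum is r! times the determinant of the matrix [f k = f l], which is 1 if f is
   injective and 0 otherwise, and there are n (n - 1) ... (n - r + 1) injective f. *)
theory Submission
  imports Defs "HOL-Algebra.Multiplicative_Group" "Jordan_Normal_Form.Spectral_Radius"
    "Jordan_Normal_Form.Schur_Decomposition"
begin

subsection \<open>Sums over tuples and bordered determinants\<close>

text \<open>Serves both for the tuples of group elements and for the index tuples \<open>f\<close>;
  over \<open>carrier G\<close> it coincides with \<open>group_tuples\<close>.\<close>

abbreviation tuples :: "'a set \<Rightarrow> nat \<Rightarrow> 'a list set" where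
  "tuples S r \<equiv> {xs. set xs \<subseteq> S \<and> length xs = r}"

lemma sum_tuples_Suc:
  "(\<Sum>xs \<in> tuples S (Suc r). F xs) = (\<Sum>a \<in> S. \<Sum>xs \<in> tuples S r. F (a # xs))"
proof -
  have "tuples S (Suc r) = (\<lambda>(a, xs). a # xs) ` (S \<times> tuples S r)"
    by (force simp: length_Suc_conv image_iff)
  moreover have "inj_on (\<lambda>(a, xs). a # xs) (S \<times> tuples S r)"
    by (auto simp: inj_on_def)
  ultimately show ?thesis
    by (simp add: sum.reindex sum.cartesian_product case_prod_unfold)
qed

text \<open>Distributivity, one coordinate at a time. This is what reduces a sum over group tuples
  to \<open>r\<close> separate sums over the group, to which Schur orthogonality applies.\<close>

lemma sum_prod_tuples:
  fixes F :: "nat \<Rightarrow> 'a \<Rightarrow> 'b :: comm_semiring_1"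
  shows "(\<Sum>xs \<in> tuples S r. \<Prod>k<r. F k (xs ! k)) = (\<Prod>k<r. \<Sum>a \<in> S. F k a)"
proof (induction r arbitrary: F)
  case 0
  have "tuples S 0 = {[]}" by auto
  then show ?case by simp
next
  case (Suc r)
  have "(\<Sum>xs \<in> tuples S (Suc r). \<Prod>k<Suc r. F k (xs ! k))
      = (\<Sum>a \<in> S. F 0 a * (\<Sum>xs \<in> tuples S r. \<Prod>k<r. F (Suc k) (xs ! k)))"
    by (simp add: sum_tuples_Suc prod.lessThan_Suc_shift sum_distrib_left del: prod.lessThan_Suc)
  also have "\<dots> = (\<Prod>k<Suc r. \<Sum>a \<in> S. F k a)"
    by (simp add: Suc.IH[of "\<lambda>k. F (Suc k)"] prod.lessThan_Suc_shift sum_distrib_right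
        del: prod.lessThan_Suc)
  finally show ?case .
qed

text \<open>Expand along row 0. Every minor except that of the corner still contains the border
  column, so it is expanded again along that column, which leaves the minors of \<open>B\<close>.
  The signs (-1)^(l+1) and (-1)^k combine to minus the sign of the \<open>(k, l)\<close>
  cofactor.\<close>

lemma det_bordered:
  fixes B :: "'a :: comm_ring_1 mat"
  assumes M: "M \<in> carrier_mat (Suc r) (Suc r)"
    and B: "B = mat r r (\<lambda>(k, l). M $$ (Suc k, Suc l))"
  shows "det M = M $$ (0, 0) * det B
      - (\<Sum>k<r. \<Sum>l<r. M $$ (Suc k, 0) * M $$ (0, Suc l) * cofactor B k l)"
proof -
  have M00: "mat_delete M 0 0 = B"
    using M unfolding mat_delete_def B by (intro eq_matI) auto
  have cof: "cofactor M 0 (Suc l) = - (\<Sum>k<r. M $$ (Suc k, 0) * cofactor B k l)" if l: "l < r" for l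
  proof -
    let ?N = "mat_delete M 0 (Suc l)"
    have N: "?N \<in> carrier_mat r r"
      using mat_delete_carrier[OF M] by simp
    have "det ?N = (\<Sum>k<r. ?N $$ (k, 0) * cofactor ?N k 0)"
      using laplace_expansion_column[OF N, of 0] l by simp
    also have "\<dots> = (\<Sum>k<r. M $$ (Suc k, 0) * ((-1) ^ k * det (mat_delete B k l)))"
    proof (intro sum.cong refl)
      fix k assume k: "k \<in> {..<r}"
      have "mat_delete ?N k 0 = mat_delete B k l"
        using M l k unfolding mat_delete_def B by (intro eq_matI) auto
      moreover have "?N $$ (k, 0) = M $$ (Suc k, 0)"
        using M l k unfolding mat_delete_def by auto
      ultimately show "?N $$ (k, 0) * cofactor ?N k 0
          = M $$ (Suc k, 0) * ((-1) ^ k * det (mat_delete B k l))"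
        unfolding cofactor_def by simp
    qed
    finally show ?thesis
      unfolding cofactor_def
      by (simp add: sum_distrib_left power_add mult_ac sum_negf)
  qed
  have "det M = M $$ (0, 0) * cofactor M 0 0 + (\<Sum>l<r. M $$ (0, Suc l) * cofactor M 0 (Suc l))"
    using laplace_expansion_row[OF M, of 0] by (simp add: sum.lessThan_Suc_shift del: sum.lessThan_Suc)
  also have "(\<Sum>l<r. M $$ (0, Suc l) * cofactor M 0 (Suc l))
      = - (\<Sum>l<r. \<Sum>k<r. M $$ (Suc k, 0) * M $$ (0, Suc l) * cofactor B k l)"
    by (simp add: cof sum_distrib_left mult_ac sum_negf)
  also have "(\<Sum>l<r. \<Sum>k<r. M $$ (Suc k, 0) * M $$ (0, Suc l) * cofactor B k l)
      = (\<Sum>k<r. \<Sum>l<r. M $$ (Suc k, 0) * M $$ (0, Suc l) * cofactor B k l)"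
    by (rule sum.swap)
  finally show ?thesis
    by (simp add: cofactor_def M00)
qed

text \<open>Laplace expansion along row \<open>k\<close>, whose cofactors do not see that row. It
  turns the inner sum over \<open>l\<close> in \<open>det_bordered\<close> back into a
  determinant.\<close>

lemma det_replace_row:
  fixes B :: "'a :: comm_ring_1 mat"
  assumes B: "B \<in> carrier_mat r r" and k: "k < r"
  shows "det (mat r r (\<lambda>(i, l). if i = k then w l else B $$ (i, l))) = (\<Sum>l<r. w l * cofactor B k l)"
proof -
  let ?B = "mat r r (\<lambda>(i, l). if i = k then w l else B $$ (i, l))"
  have "det ?B = (\<Sum>l<r. ?B $$ (k, l) * cofactor ?B k l)"
    by (rule laplace_expansion_row[OF _ k]) simp
  moreover have "cofactor ?B k l = cofactor B k l" if "l < r" for l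
  proof -
    have "mat_delete ?B k l = mat_delete B k l"
      using B k that unfolding mat_delete_def by (intro eq_matI) auto
    then show ?thesis by (simp add: cofactor_def)
  qed
  ultimately show ?thesis using k by simp
qed

subsection \<open>Frobenius characters as sums of determinants\<close>

lemma complex_representationD:
  assumes "group G" and "complex_representation G n \<rho>"
  shows "g \<in> carrier G \<Longrightarrow> \<rho> g \<in> carrier_mat n n"
    and "g \<in> carrier G \<Longrightarrow> h \<in> carrier G \<Longrightarrow> \<rho> (g \<otimes>\<^bsub>G\<^esub> h) = \<rho> g * \<rho> h"
    and "\<rho> \<one>\<^bsub>G\<^esub> = 1\<^sub>m n"
proof -
  have \<rho>: "\<rho> \<in> hom G (units_of (ring_mat TYPE(complex) n ()))"
    using assms(2) by (simp add: complex_representation_def)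
  interpret R: ring "ring_mat TYPE(complex) n ()" by (rule ring_mat)
  show "g \<in> carrier G \<Longrightarrow> \<rho> g \<in> carrier_mat n n"
    using hom_in_carrier[OF \<rho>, of g] by (auto simp: units_of_def Units_def ring_mat_def)
  show "g \<in> carrier G \<Longrightarrow> h \<in> carrier G \<Longrightarrow> \<rho> (g \<otimes>\<^bsub>G\<^esub> h) = \<rho> g * \<rho> h"
    using hom_mult[OF \<rho>] by (simp add: units_of_def ring_mat_def)
  show "\<rho> \<one>\<^bsub>G\<^esub> = 1\<^sub>m n"
    using hom_one[OF \<rho> assms(1) R.units_group] by (simp add: units_of_def ring_mat_def)
qed

text \<open>Invertibility of \<open>\<rho> g\<close> comes from the other conditions, the inverse
  being the matrix of the inverse element.\<close>

lemma complex_representationI: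
  assumes "group G"
    and c: "\<And>g. g \<in> carrier G \<Longrightarrow> \<rho> g \<in> carrier_mat n n"
    and m: "\<And>g h. g \<in> carrier G \<Longrightarrow> h \<in> carrier G \<Longrightarrow> \<rho> (g \<otimes>\<^bsub>G\<^esub> h) = \<rho> g * \<rho> h"
    and 1: "\<rho> \<one>\<^bsub>G\<^esub> = 1\<^sub>m n"
  shows "complex_representation G n \<rho>"
proof -
  interpret group G by fact
  have "\<rho> g \<in> Units (ring_mat TYPE(complex) n ())" if g: "g \<in> carrier G" for g
  proof -
    have "\<rho> (inv\<^bsub>G\<^esub> g) * \<rho> g = 1\<^sub>m n" "\<rho> g * \<rho> (inv\<^bsub>G\<^esub> g) = 1\<^sub>m n"
      using g m[of g "inv\<^bsub>G\<^esub> g"] m[of "inv\<^bsub>G\<^esub> g" g] 1 by auto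
    then show ?thesis
      using g c[of g] c[of "inv\<^bsub>G\<^esub> g"] by (auto simp: Units_def ring_mat_def)
  qed
  then show ?thesis
    using m unfolding complex_representation_def hom_def
    by (auto simp: units_of_def ring_mat_def)
qed

text \<open>With the value 1 at the empty list the recursion covers length one as well, so induction
  can start from the empty list.\<close>

lemma frobenius_char_Cons:
  "frobenius_char G \<phi> (g # hs) = \<phi> g * frobenius_char G \<phi> hs
    - (\<Sum>k < length hs. frobenius_char G \<phi> (hs[k := g \<otimes>\<^bsub>G\<^esub> hs ! k]))"
  by (cases hs) (simp_all add: Let_def)

lemma frobenius_char_eq_sum_det:
  assumes G: "group G" and \<rho>: "complex_representation G n \<rho>"
    and \<phi>: "\<And>g. g \<in> carrier G \<Longrightarrow> \<phi> g = mat_trace (\<rho> g)"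
  shows "gs \<in> tuples (carrier G) r \<Longrightarrow> frobenius_char G \<phi> gs
    = (\<Sum>f \<in> tuples {..<n} r. det (mat r r (\<lambda>(k, l). \<rho> (gs ! k) $$ (f ! l, f ! k))))"
proof (induction r arbitrary: gs)
  case 0
  have "tuples {..<n} 0 = {[]}" by auto
  with 0 show ?case by (simp add: det_def)
next
  case (Suc r)
  interpret group G by fact
  note rep = complex_representationD[OF G \<rho>]
  let ?I = "tuples {..<n} r"
  obtain g hs where gs: "gs = g # hs" and g: "g \<in> carrier G" and hs: "hs \<in> tuples (carrier G) r"
    using Suc.prems by (cases gs) auto
  have hk: "hs ! k \<in> carrier G" if "k < r" for k
    using hs that nth_mem by fastforce
  have fl: "f ! l < n" if "f \<in> ?I" "l < r" for f l
    using that nth_mem by fastforce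
  define B where "B f = mat r r (\<lambda>(k, l). \<rho> (hs ! k) $$ (f ! l, f ! k))" for f
  have B: "B f \<in> carrier_mat r r" for f by (simp add: B_def)
  \<comment> \<open>Multiplying entry \<open>k\<close> by \<open>g\<close> alters only row
    \<open>k\<close> of the matrix: its entry in column \<open>l\<close> becomes the
    \<open>(f ! l, f ! k)\<close> entry of \<open>\<rho> g * \<rho> (hs ! k)\<close>. The
    determinant is then expanded along that row.\<close>
  have upd: "frobenius_char G \<phi> (hs[k := g \<otimes>\<^bsub>G\<^esub> hs ! k])
      = (\<Sum>f \<in> ?I. \<Sum>l<r. (\<Sum>a<n. \<rho> g $$ (f ! l, a) * \<rho> (hs ! k) $$ (a, f ! k)) * cofactor (B f) k l)"
    if k: "k < r" for k
  proof -
    have "hs[k := g \<otimes>\<^bsub>G\<^esub> hs ! k] \<in> tuples (carrier G) r"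
      using hs g hk[OF k] by (auto dest!: set_update_subset_insert[THEN subsetD])
    then have "frobenius_char G \<phi> (hs[k := g \<otimes>\<^bsub>G\<^esub> hs ! k]) = (\<Sum>f \<in> ?I. det (mat r r
        (\<lambda>(i, l). \<rho> (hs[k := g \<otimes>\<^bsub>G\<^esub> hs ! k] ! i) $$ (f ! l, f ! i))))"
      by (rule Suc.IH)
    also have "\<dots> = (\<Sum>f \<in> ?I. det (mat r r (\<lambda>(i, l). if i = k
        then \<Sum>a<n. \<rho> g $$ (f ! l, a) * \<rho> (hs ! k) $$ (a, f ! k) else B f $$ (i, l))))"
    proof (intro sum.cong refl arg_cong[of _ _ det] cong_mat, clarify)
      fix f i l assume f: "set f \<subseteq> {..<n}" "r = length f" and i: "i < length f" and l: "l < length f"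
      have "f ! l < n" "f ! i < n" using f i l nth_mem by blast+
      moreover have "length hs = length f" using hs f by simp
      ultimately show "\<rho> (hs[k := g \<otimes>\<^bsub>G\<^esub> hs ! k] ! i) $$ (f ! l, f ! i) = (if i = k
        then \<Sum>a<n. \<rho> g $$ (f ! l, a) * \<rho> (hs ! k) $$ (a, f ! k) else B f $$ (i, l))"
        using i l k rep(1)[OF g] rep(1)[OF hk[OF k]] rep(2)[OF g hk[OF k]] f
        by (auto simp: B_def scalar_prod_def atLeast0LessThan)
    qed
    also have "\<dots> = (\<Sum>f \<in> ?I. \<Sum>l<r.
        (\<Sum>a<n. \<rho> g $$ (f ! l, a) * \<rho> (hs ! k) $$ (a, f ! k)) * cofactor (B f) k l)"
      by (simp add: det_replace_row[OF B k])
    finally show ?thesis .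
  qed
  \<comment> \<open>Summed over the border index a, the products below become entries of
    the matrix of g times the matrix of the k-th entry of hs, as in upd.\<close>
  have border: "det (mat (Suc r) (Suc r) (\<lambda>(k, l). \<rho> (gs ! k) $$ ((a # f) ! l, (a # f) ! k)))
      = \<rho> g $$ (a, a) * det (B f)
        - (\<Sum>k<r. \<Sum>l<r. \<rho> g $$ (f ! l, a) * \<rho> (hs ! k) $$ (a, f ! k) * cofactor (B f) k l)" for a f
    by (subst det_bordered[of _ r "B f"]) (auto simp: B_def gs mult_ac intro!: cong_mat)
  have "(\<Sum>f \<in> tuples {..<n} (Suc r).
        det (mat (Suc r) (Suc r) (\<lambda>(k, l). \<rho> (gs ! k) $$ (f ! l, f ! k))))
      = (\<Sum>a<n. \<Sum>f\<in>?I. \<rho> g $$ (a, a) * det (B f))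
        - (\<Sum>a<n. \<Sum>f\<in>?I. \<Sum>k<r. \<Sum>l<r.
            \<rho> g $$ (f ! l, a) * \<rho> (hs ! k) $$ (a, f ! k) * cofactor (B f) k l)"
    by (simp only: sum_tuples_Suc border sum_subtractf)
  also have "(\<Sum>a<n. \<Sum>f\<in>?I. \<rho> g $$ (a, a) * det (B f)) = \<phi> g * frobenius_char G \<phi> hs"
    using rep(1)[OF g] unfolding Suc.IH[OF hs] \<phi>[OF g] mat_trace_def B_def
    by (simp add: sum_product)
  also have "(\<Sum>a<n. \<Sum>f\<in>?I. \<Sum>k<r. \<Sum>l<r.
            \<rho> g $$ (f ! l, a) * \<rho> (hs ! k) $$ (a, f ! k) * cofactor (B f) k l)
      = (\<Sum>f\<in>?I. \<Sum>k<r. \<Sum>l<r. \<Sum>a<n.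
            \<rho> g $$ (f ! l, a) * \<rho> (hs ! k) $$ (a, f ! k) * cofactor (B f) k l)"
    by (simp only: sum.swap[of _ _ "{..<n}"])
  also have "\<dots> = (\<Sum>k<r. frobenius_char G \<phi> (hs[k := g \<otimes>\<^bsub>G\<^esub> hs ! k]))"
    by (subst sum.swap) (simp add: upd sum_distrib_right)
  finally show ?case
    using hs by (simp add: gs frobenius_char_Cons)
qed

subsection \<open>Schur orthogonality\<close>

text \<open>Replaces the module-theoretic notion of subspace in the definition of irreducibility by
  plain closure conditions on a set of vectors.\<close>

lemma irreducible_representation_subspace:
  assumes "irreducible_representation G n \<rho>"
    and W: "W \<subseteq> carrier_vec n" "0\<^sub>v n \<in> W"
      "\<And>v w. v \<in> W \<Longrightarrow> w \<in> W \<Longrightarrow> v + w \<in> W" "\<And>c v. v \<in> W \<Longrightarrow> c \<cdot>\<^sub>v v \<in> W"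
    and inv: "\<And>g w. g \<in> carrier G \<Longrightarrow> w \<in> W \<Longrightarrow> \<rho> g *\<^sub>v w \<in> W"
  shows "W = {0\<^sub>v n} \<or> W = carrier_vec n"
proof -
  interpret vec_module "TYPE(complex)" n .
  have "submodule class_ring W (module_vec TYPE(complex) n)"
    using W module_axioms by (auto simp: submodule_def module_vec_simps)
  then have "VectorSpace.subspace class_ring W (module_vec TYPE(complex) n)"
    using vec_vs by (simp add: VectorSpace.subspace_def)
  then show ?thesis
    using assms(1) inv by (auto simp: irreducible_representation_def)
qed

section \<open>Schur's lemma for matrix representations\<close>

lemma mat_trace_mult_commute:
  fixes A B :: "'a :: comm_semiring_0 mat"
  assumes A: "A \<in> carrier_mat n m" and B: "B \<in> carrier_mat m n"
  shows "mat_trace (A * B) = mat_trace (B * A)"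
proof -
  have "mat_trace (A * B) = (\<Sum>i<n. \<Sum>j<m. A $$ (i, j) * B $$ (j, i))"
    using A B by (simp add: mat_trace_def scalar_prod_def atLeast0LessThan)
  also have "\<dots> = (\<Sum>j<m. \<Sum>i<n. B $$ (j, i) * A $$ (i, j))"
    by (subst sum.swap) (simp add: mult.commute)
  also have "\<dots> = mat_trace (B * A)"
    using A B by (simp add: mat_trace_def scalar_prod_def atLeast0LessThan)
  finally show ?thesis .
qed

lemma mat_eqI_mult_vec:
  fixes A B :: "'a :: semiring_1 mat"
  assumes A: "A \<in> carrier_mat n m" and B: "B \<in> carrier_mat n m"
    and eq: "\<And>v. v \<in> carrier_vec m \<Longrightarrow> A *\<^sub>v v = B *\<^sub>v v"
  shows "A = B"
proof (rule eq_matI)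
  fix i j assume ij: "i < dim_row B" "j < dim_col B"
  have "(A *\<^sub>v unit_vec m j) $ i = (B *\<^sub>v unit_vec m j) $ i"
    by (simp add: eq)
  then show "A $$ (i, j) = B $$ (i, j)"
    using A B ij by simp
qed (use A B in auto)

text \<open>Kernel and range of an intertwiner are invariant subspaces. If \<open>T\<close> is
  nonzero, irreducibility makes the kernel zero and the range everything, so \<open>T\<close> has a
  two-sided inverse and conjugates one representation into the other; conjugate matrices have equal
  trace.\<close>

lemma intertwiner_zero_or_character_eq:
  assumes G: "group G"
    and \<rho>: "irreducible_representation G n \<rho>" and \<sigma>: "irreducible_representation G m \<sigma>"
    and T: "T \<in> carrier_mat n m"
    and comm: "\<And>g. g \<in> carrier G \<Longrightarrow> \<rho> g * T = T * \<sigma> g"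
  shows "T = 0\<^sub>m n m \<or> (\<forall>g \<in> carrier G. mat_trace (\<rho> g) = mat_trace (\<sigma> g))"
proof (cases "T = 0\<^sub>m n m")
  case False
  have \<rho>c: "\<rho> g \<in> carrier_mat n n" if "g \<in> carrier G" for g
    using complex_representationD(1)[OF G _ that] \<rho> by (auto simp: irreducible_representation_def)
  have \<sigma>c: "\<sigma> g \<in> carrier_mat m m" if "g \<in> carrier G" for g
    using complex_representationD(1)[OF G _ that] \<sigma> by (auto simp: irreducible_representation_def)
  have act: "\<rho> g *\<^sub>v (T *\<^sub>v v) = T *\<^sub>v (\<sigma> g *\<^sub>v v)"
    if "g \<in> carrier G" "v \<in> carrier_vec m" for g v
    using assoc_mult_mat_vec[OF \<rho>c[OF that(1)] T that(2)]
      assoc_mult_mat_vec[OF T \<sigma>c[OF that(1)] that(2)] comm[OF that(1)] by simp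
  let ?K = "{v \<in> carrier_vec m. T *\<^sub>v v = 0\<^sub>v n}"
  have "?K = {0\<^sub>v m} \<or> ?K = carrier_vec m"
  proof (rule irreducible_representation_subspace[OF \<sigma>])
    show "\<sigma> g *\<^sub>v w \<in> ?K" if "g \<in> carrier G" "w \<in> ?K" for g w
    proof -
      have "\<rho> g *\<^sub>v 0\<^sub>v n = 0\<^sub>v n"
        using \<rho>c[OF that(1)] by (intro eq_vecI) auto
      then show ?thesis
        using that act[of g w] \<sigma>c[of g] by auto
    qed
  qed (use T in \<open>auto simp: mult_add_distrib_mat_vec mult_mat_vec\<close>)
  moreover have "?K \<noteq> carrier_vec m"
  proof
    assume K: "?K = carrier_vec m"
    have "T *\<^sub>v v = 0\<^sub>m n m *\<^sub>v v" if "v \<in> carrier_vec m" for v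
    proof -
      have "v \<in> ?K" using K that by simp
      then show ?thesis using that by (intro eq_vecI) auto
    qed
    then have "T = 0\<^sub>m n m"
      using T by (intro mat_eqI_mult_vec[of _ n m]) auto
    with False show False ..
  qed
  ultimately have ker: "?K = {0\<^sub>v m}" by blast
  let ?R = "(\<lambda>v. T *\<^sub>v v) ` carrier_vec m"
  have "?R = {0\<^sub>v n} \<or> ?R = carrier_vec n"
  proof (rule irreducible_representation_subspace[OF \<rho>])
    show "?R \<subseteq> carrier_vec n" using T by auto
    show "0\<^sub>v n \<in> ?R" using T by (intro image_eqI[of _ _ "0\<^sub>v m"]) auto
    show "\<rho> g *\<^sub>v w \<in> ?R" if "g \<in> carrier G" "w \<in> ?R" for g w
      using that \<sigma>c[of g] by (auto simp: act)
    show "v + w \<in> ?R" if "v \<in> ?R" "w \<in> ?R" for v w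
      using that T by (auto simp flip: mult_add_distrib_mat_vec)
    show "c \<cdot>\<^sub>v v \<in> ?R" if "v \<in> ?R" for c v
      using that T by (auto simp flip: mult_mat_vec)
  qed
  moreover have "?R \<noteq> {0\<^sub>v n}"
    using \<open>?K \<noteq> carrier_vec m\<close> by auto
  ultimately have ran: "?R = carrier_vec n" by blast
  \<comment> \<open>By surjectivity each unit vector has a preimage; these preimages are the columns
    of a right inverse \<open>S\<close>.\<close>
  have "\<exists>v \<in> carrier_vec m. T *\<^sub>v v = unit_vec n i" for i
  proof -
    have "unit_vec n i \<in> ?R" unfolding ran by simp
    then show ?thesis by force
  qed
  then obtain s where s: "\<And>i. s i \<in> carrier_vec m" "\<And>i. T *\<^sub>v s i = unit_vec n i" by metis
  define S where "S = mat m n (\<lambda>(i, j). s j $ i)"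
  have S: "S \<in> carrier_mat m n" by (simp add: S_def)
  have TS: "T * S = 1\<^sub>m n"
  proof (rule eq_matI)
    fix i j assume ij: "i < dim_row (1\<^sub>m n :: complex mat)" "j < dim_col (1\<^sub>m n :: complex mat)"
    have "col S j = s j"
      using s(1)[of j] ij by (intro eq_vecI) (auto simp: S_def)
    then have "(T * S) $$ (i, j) = (T *\<^sub>v s j) $ i"
      using T S ij by simp
    then show "(T * S) $$ (i, j) = 1\<^sub>m n $$ (i, j)"
      using ij s(2)[of j] by simp
  qed (use T S in auto)
  \<comment> \<open>The right inverse is also a left inverse because \<open>T\<close> is injective:
    \<open>S *\<^sub>v (T *\<^sub>v v) - v\<close> lies in the kernel.\<close>
  have ST: "S * T = 1\<^sub>m m"
  proof (rule mat_eqI_mult_vec[of _ m m])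
    fix v :: "complex vec" assume v: "v \<in> carrier_vec m"
    have STv: "S *\<^sub>v (T *\<^sub>v v) \<in> carrier_vec m" using S T v by auto
    have "T *\<^sub>v (S *\<^sub>v (T *\<^sub>v v)) = (T * S) *\<^sub>v (T *\<^sub>v v)"
      using S T v by (intro assoc_mult_mat_vec[symmetric]) auto
    also have "\<dots> = T *\<^sub>v v" using T v by (simp add: TS)
    finally have "T *\<^sub>v (S *\<^sub>v (T *\<^sub>v v) - v) = 0\<^sub>v n"
      using T v STv by (simp add: mult_minus_distrib_mat_vec)
    then have "S *\<^sub>v (T *\<^sub>v v) - v \<in> ?K" using STv v by simp
    then have d: "S *\<^sub>v (T *\<^sub>v v) - v = 0\<^sub>v m" unfolding ker by simp
    have "S *\<^sub>v (T *\<^sub>v v) = v"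
    proof (rule eq_vecI)
      fix i assume i: "i < dim_vec v"
      have "(S *\<^sub>v (T *\<^sub>v v) - v) $ i = 0" unfolding d using i v by simp
      then show "(S *\<^sub>v (T *\<^sub>v v)) $ i = v $ i" using i by simp
    qed (use S v in auto)
    then show "(S * T) *\<^sub>v v = 1\<^sub>m m *\<^sub>v v"
      using assoc_mult_mat_vec[OF S T v] v by simp
  qed (use S T in auto)
  have "mat_trace (\<rho> g) = mat_trace (\<sigma> g)" if g: "g \<in> carrier G" for g
  proof -
    note c = \<rho>c[OF g] \<sigma>c[OF g]
    have "\<rho> g = \<rho> g * (T * S)" using c by (simp add: TS)
    also have "\<dots> = T * (\<sigma> g * S)"
      using c S T comm[OF g] by (simp flip: assoc_mult_mat)
    finally have "mat_trace (\<rho> g) = mat_trace (T * (\<sigma> g * S))" by simp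
    also have "\<dots> = mat_trace (\<sigma> g * S * T)"
      using c S T by (intro mat_trace_mult_commute[of _ n m]) auto
    also have "\<sigma> g * S * T = \<sigma> g"
      using c S T ST by (simp add: assoc_mult_mat[of _ m m _ n])
    finally show ?thesis .
  qed
  then show ?thesis by simp
qed simp

text \<open>Over the complex numbers \<open>T\<close> has an eigenvalue. Its eigenspace is
  invariant, since \<open>T\<close> commutes with the action, and nonzero, so by irreducibility it
  is the whole space.\<close>

lemma intertwiner_scalar:
  assumes G: "group G" and \<rho>: "irreducible_representation G n \<rho>"
    and T: "T \<in> carrier_mat n n"
    and comm: "\<And>g. g \<in> carrier G \<Longrightarrow> \<rho> g * T = T * \<rho> g"
  shows "\<exists>c. T = c \<cdot>\<^sub>m 1\<^sub>m n"
proof -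
  have \<rho>c: "\<rho> g \<in> carrier_mat n n" if "g \<in> carrier G" for g
    using complex_representationD(1)[OF G _ that] \<rho> by (auto simp: irreducible_representation_def)
  have "n > 0" using \<rho> by (simp add: irreducible_representation_def)
  then obtain c where "eigenvalue T c"
    using spectrum_non_empty[OF T] by (auto simp: spectrum_def)
  then obtain v where v: "v \<in> carrier_vec n" "v \<noteq> 0\<^sub>v n" "T *\<^sub>v v = c \<cdot>\<^sub>v v"
    using T by (auto simp: eigenvalue_def eigenvector_def)
  let ?W = "{w \<in> carrier_vec n. T *\<^sub>v w = c \<cdot>\<^sub>v w}"
  have "?W = {0\<^sub>v n} \<or> ?W = carrier_vec n"
  proof (rule irreducible_representation_subspace[OF \<rho>])
    show "\<rho> g *\<^sub>v w \<in> ?W" if "g \<in> carrier G" "w \<in> ?W" for g w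
    proof -
      have w: "w \<in> carrier_vec n" "T *\<^sub>v w = c \<cdot>\<^sub>v w" using that by auto
      note r = \<rho>c[OF that(1)]
      have "T *\<^sub>v (\<rho> g *\<^sub>v w) = \<rho> g *\<^sub>v (T *\<^sub>v w)"
        using assoc_mult_mat_vec[OF r T w(1)] assoc_mult_mat_vec[OF T r w(1)] comm[OF that(1)] by simp
      also have "\<dots> = c \<cdot>\<^sub>v (\<rho> g *\<^sub>v w)"
        using r w by (simp add: mult_mat_vec)
      finally show ?thesis using r w by auto
    qed
  qed (use T in \<open>auto simp: mult_add_distrib_mat_vec mult_mat_vec smult_add_distrib_vec
        smult_smult_assoc mult.commute\<close>)
  with v have W: "?W = carrier_vec n" by auto
  have "T = c \<cdot>\<^sub>m 1\<^sub>m n"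
  proof (rule mat_eqI_mult_vec[OF T])
    fix w :: "complex vec" assume w: "w \<in> carrier_vec n"
    then have "T *\<^sub>v w = c \<cdot>\<^sub>v w" using W by blast
    also have "\<dots> = (c \<cdot>\<^sub>m 1\<^sub>m n) *\<^sub>v w"
      using w by (intro eq_vecI) (auto simp: scalar_prod_left_unit)
    finally show "T *\<^sub>v w = (c \<cdot>\<^sub>m 1\<^sub>m n) *\<^sub>v w" .
  qed simp
  then show ?thesis ..
qed

section \<open>Orthogonality of matrix entries\<close>

text \<open>The matrix T is the average of the matrix unit with entry 1 in position (b, d).\<close>

lemma averaged_intertwiner:
  assumes G: "group G"
    and \<rho>: "complex_representation G n \<rho>" and \<sigma>: "complex_representation G m \<sigma>"
    and b: "b < n" and d: "d < m" and h: "h \<in> carrier G"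
  defines "T \<equiv> mat n m (\<lambda>(a, c). \<Sum>g \<in> carrier G. \<rho> g $$ (a, b) * \<sigma> (inv\<^bsub>G\<^esub> g) $$ (d, c))"
  shows "\<rho> h * T = T * \<sigma> h"
proof -
  interpret group G by fact
  note R = complex_representationD[OF G \<rho>] and S = complex_representationD[OF G \<sigma>]
  have T: "T \<in> carrier_mat n m" by (simp add: T_def)
  have bij: "bij_betw (\<lambda>g. h \<otimes>\<^bsub>G\<^esub> g) (carrier G) (carrier G)"
    using h by (intro bij_betw_byWitness[where f' = "\<lambda>g. inv\<^bsub>G\<^esub> h \<otimes>\<^bsub>G\<^esub> g"])
      (auto simp flip: m_assoc)
  show ?thesis
  proof (rule eq_matI)
    fix a c assume "a < dim_row (T * \<sigma> h)" "c < dim_col (T * \<sigma> h)"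
    then have a: "a < n" and c: "c < m" using T S(1)[OF h] by auto
    have "(\<rho> h * T) $$ (a, c)
        = (\<Sum>x<n. \<rho> h $$ (a, x) * (\<Sum>g\<in>carrier G. \<rho> g $$ (x, b) * \<sigma> (inv\<^bsub>G\<^esub> g) $$ (d, c)))"
      using a c R(1)[OF h] by (simp add: T_def scalar_prod_def atLeast0LessThan)
    also have "\<dots> = (\<Sum>g\<in>carrier G. (\<Sum>x<n. \<rho> h $$ (a, x) * \<rho> g $$ (x, b)) * \<sigma> (inv\<^bsub>G\<^esub> g) $$ (d, c))"
      unfolding sum_distrib_left sum_distrib_right by (subst sum.swap) (simp add: mult_ac)
    also have "\<dots> = (\<Sum>g\<in>carrier G. \<rho> (h \<otimes>\<^bsub>G\<^esub> g) $$ (a, b) * \<sigma> (inv\<^bsub>G\<^esub> g) $$ (d, c))"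
    proof (intro sum.cong refl)
      fix g assume g: "g \<in> carrier G"
      show "(\<Sum>x<n. \<rho> h $$ (a, x) * \<rho> g $$ (x, b)) * \<sigma> (inv\<^bsub>G\<^esub> g) $$ (d, c)
          = \<rho> (h \<otimes>\<^bsub>G\<^esub> g) $$ (a, b) * \<sigma> (inv\<^bsub>G\<^esub> g) $$ (d, c)"
        using R(1)[OF h] R(1)[OF g] R(2)[OF h g] a b
        by (simp add: scalar_prod_def atLeast0LessThan)
    qed
    \<comment> \<open>Writing the inverse of \<open>g\<close> as the inverse of \<open>hg\<close>
      times \<open>h\<close> makes the summand a function of \<open>hg\<close> alone, so left
      translation by \<open>h\<close> reindexes the sum.\<close>
    also have "\<dots> = (\<Sum>g\<in>carrier G. \<rho> (h \<otimes>\<^bsub>G\<^esub> g) $$ (a, b) * \<sigma> (inv\<^bsub>G\<^esub> (h \<otimes>\<^bsub>G\<^esub> g) \<otimes>\<^bsub>G\<^esub> h) $$ (d, c))"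
      using h by (intro sum.cong refl) (simp add: inv_mult_group m_assoc)
    also have "\<dots> = (\<Sum>g\<in>carrier G. \<rho> g $$ (a, b) * \<sigma> (inv\<^bsub>G\<^esub> g \<otimes>\<^bsub>G\<^esub> h) $$ (d, c))"
      by (rule sum.reindex_bij_betw[OF bij])
    also have "\<dots> = (\<Sum>g\<in>carrier G. \<rho> g $$ (a, b) * (\<Sum>x<m. \<sigma> (inv\<^bsub>G\<^esub> g) $$ (d, x) * \<sigma> h $$ (x, c)))"
    proof (intro sum.cong refl)
      fix g assume g: "g \<in> carrier G"
      then have "inv\<^bsub>G\<^esub> g \<in> carrier G" by simp
      from S(1)[OF h] S(1)[OF this] S(2)[OF this h] c d
      show "\<rho> g $$ (a, b) * \<sigma> (inv\<^bsub>G\<^esub> g \<otimes>\<^bsub>G\<^esub> h) $$ (d, c)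
          = \<rho> g $$ (a, b) * (\<Sum>x<m. \<sigma> (inv\<^bsub>G\<^esub> g) $$ (d, x) * \<sigma> h $$ (x, c))"
        by (simp add: scalar_prod_def atLeast0LessThan)
    qed
    also have "\<dots> = (\<Sum>x<m. (\<Sum>g\<in>carrier G. \<rho> g $$ (a, b) * \<sigma> (inv\<^bsub>G\<^esub> g) $$ (d, x)) * \<sigma> h $$ (x, c))"
      unfolding sum_distrib_left sum_distrib_right by (subst sum.swap) (simp add: mult_ac)
    also have "\<dots> = (T * \<sigma> h) $$ (a, c)"
      using a c S(1)[OF h] by (simp add: T_def scalar_prod_def atLeast0LessThan)
    finally show "(\<rho> h * T) $$ (a, c) = (T * \<sigma> h) $$ (a, c)" .
  qed (use T R(1)[OF h] S(1)[OF h] in auto)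
qed

text \<open>The sum is an entry of the averaged matrix unit. This is an intertwiner, and it must
  vanish because the characters differ at some element.\<close>

lemma schur_orthogonality_distinct:
  assumes G: "group G"
    and \<rho>: "irreducible_representation G n \<rho>" and \<sigma>: "irreducible_representation G m \<sigma>"
    and ne: "g \<in> carrier G" "mat_trace (\<rho> g) \<noteq> mat_trace (\<sigma> g)"
    and "a < n" "b < n" "c < m" "d < m"
  shows "(\<Sum>g \<in> carrier G. \<rho> g $$ (a, b) * \<sigma> (inv\<^bsub>G\<^esub> g) $$ (d, c)) = 0"
proof -
  let ?T = "mat n m (\<lambda>(a, c). \<Sum>g \<in> carrier G. \<rho> g $$ (a, b) * \<sigma> (inv\<^bsub>G\<^esub> g) $$ (d, c))"
  have "?T = 0\<^sub>m n m"
    using intertwiner_zero_or_character_eq[OF G \<rho> \<sigma>, of ?T]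
      averaged_intertwiner[OF G, of n \<rho> m \<sigma> b d] assms
    by (auto simp: irreducible_representation_def)
  then have "?T $$ (a, c) = 0" using assms by simp
  then show ?thesis using assms by simp
qed

text \<open>Here the averaged matrix unit is a scalar matrix, and the scalar \<open>s\<close> is
  found from its trace.\<close>

lemma schur_orthogonality_same:
  assumes G: "group G" and \<rho>: "irreducible_representation G n \<rho>"
    and "a < n" "b < n" "c < n" "d < n"
  shows "(\<Sum>g \<in> carrier G. \<rho> g $$ (a, b) * \<rho> (inv\<^bsub>G\<^esub> g) $$ (d, c))
    = (if a = c \<and> b = d then of_nat (card (carrier G)) / of_nat n else 0)"
proof -
  interpret group G by fact
  have \<rho>': "complex_representation G n \<rho>" and n: "n > 0"
    using \<rho> by (auto simp: irreducible_representation_def)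
  note R = complex_representationD[OF G \<rho>']
  let ?T = "mat n n (\<lambda>(a, c). \<Sum>g \<in> carrier G. \<rho> g $$ (a, b) * \<rho> (inv\<^bsub>G\<^esub> g) $$ (d, c))"
  obtain s where s: "?T = s \<cdot>\<^sub>m 1\<^sub>m n"
    using intertwiner_scalar[OF G \<rho>, of ?T] averaged_intertwiner[OF G \<rho>' \<rho>', of b d] assms
    by auto
  have ent: "(\<Sum>g \<in> carrier G. \<rho> g $$ (x, b) * \<rho> (inv\<^bsub>G\<^esub> g) $$ (d, y)) = (if x = y then s else 0)"
    if "x < n" "y < n" for x y
  proof -
    have "?T $$ (x, y) = (s \<cdot>\<^sub>m 1\<^sub>m n) $$ (x, y)" by (simp only: s)
    then show ?thesis using that by simp
  qed
  \<comment> \<open>Both sides are the trace of \<open>?T\<close>. With the factors interchanged,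
    the sum over \<open>x\<close> is the \<open>(d, b)\<close> entry of the matrix of the identity
    element, for each \<open>g\<close>.\<close>
  have "of_nat n * s = (\<Sum>x<n. \<Sum>g \<in> carrier G. \<rho> g $$ (x, b) * \<rho> (inv\<^bsub>G\<^esub> g) $$ (d, x))"
    by (simp add: ent)
  also have "\<dots> = (\<Sum>g \<in> carrier G. \<Sum>x<n. \<rho> (inv\<^bsub>G\<^esub> g) $$ (d, x) * \<rho> g $$ (x, b))"
    by (subst sum.swap) (simp add: mult.commute)
  also have "\<dots> = (\<Sum>g \<in> carrier G. if b = d then 1 else 0)"
  proof (intro sum.cong refl)
    fix g assume g: "g \<in> carrier G"
    then have g': "inv\<^bsub>G\<^esub> g \<in> carrier G" by simp
    have "(\<Sum>x<n. \<rho> (inv\<^bsub>G\<^esub> g) $$ (d, x) * \<rho> g $$ (x, b)) = \<rho> (inv\<^bsub>G\<^esub> g \<otimes>\<^bsub>G\<^esub> g) $$ (d, b)"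
      using R(1)[OF g] R(1)[OF g'] R(2)[OF g' g] assms
      by (simp add: scalar_prod_def atLeast0LessThan)
    then show "(\<Sum>x<n. \<rho> (inv\<^bsub>G\<^esub> g) $$ (d, x) * \<rho> g $$ (x, b)) = (if b = d then 1 else 0)"
      using g R(3) assms by simp
  qed
  finally have "of_nat n * s = (if b = d then of_nat (card (carrier G)) else 0)" by simp
  then have "s = (if b = d then of_nat (card (carrier G)) / of_nat n else 0)"
    using n by (auto simp: field_simps)
  then show ?thesis using ent[of a c] assms by simp
qed

subsection \<open>Complex conjugates of characters\<close>

lemma upper_triangular_pow:
  fixes B :: "'a :: comm_semiring_1 mat"
  assumes B: "B \<in> carrier_mat n n" and ut: "upper_triangular B"
  shows "upper_triangular (B ^\<^sub>m k)" and "i < n \<Longrightarrow> (B ^\<^sub>m k) $$ (i, i) = B $$ (i, i) ^ k"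
proof -
  have "upper_triangular (B ^\<^sub>m k) \<and> (\<forall>i<n. (B ^\<^sub>m k) $$ (i, i) = B $$ (i, i) ^ k)"
  proof (induction k)
    case 0
    then show ?case using B by auto
  next
    case (Suc k)
    let ?P = "B ^\<^sub>m k"
    have P: "?P \<in> carrier_mat n n" using B by (rule pow_carrier_mat)
    have ent: "(?P * B) $$ (i, j) = (\<Sum>x<n. ?P $$ (i, x) * B $$ (x, j))" if "i < n" "j < n" for i j
      using P B that by (simp add: scalar_prod_def atLeast0LessThan)
    \<comment> \<open>On or below the diagonal only the term with \<open>x\<close> =
      \<open>i\<close> = \<open>j\<close> survives: \<open>x < i\<close> kills the first factor, and
      in the other cases \<open>j < x\<close> kills the second.\<close>
    have lower: "?P $$ (i, x) * B $$ (x, j) = 0" if "i < n" "x < n" "j \<le> i" "x \<noteq> i \<or> j \<noteq> i" for i j x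
      using that Suc.IH P B ut by (cases "x < i") (auto simp: upper_triangular_def)
    show ?case
    proof (intro conjI upper_triangularI allI impI)
      fix i j assume "j < i" "i < dim_row (B ^\<^sub>m Suc k)"
      then show "(B ^\<^sub>m Suc k) $$ (i, j) = 0"
        using P by (auto simp: ent lower intro!: sum.neutral)
    next
      fix i assume i: "i < n"
      have "(\<Sum>x<n. ?P $$ (i, x) * B $$ (x, i)) = (\<Sum>x\<in>{i}. ?P $$ (i, x) * B $$ (x, i))"
        using i by (intro sum.mono_neutral_right) (auto simp: lower)
      then show "(B ^\<^sub>m Suc k) $$ (i, i) = B $$ (i, i) ^ Suc k"
        using i Suc.IH by (simp add: ent mult.commute)
    qed
  qed
  then show "upper_triangular (B ^\<^sub>m k)" and "i < n \<Longrightarrow> (B ^\<^sub>m k) $$ (i, i) = B $$ (i, i) ^ k"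
    by auto
qed

text \<open>The eigenvalues of A are roots of unity, whose inverses are their conjugates.\<close>

lemma mat_trace_pow_pred:
  fixes A :: "complex mat"
  assumes A: "A \<in> carrier_mat n n" and N: "N > 0" and one: "A ^\<^sub>m N = 1\<^sub>m n"
  shows "mat_trace (A ^\<^sub>m (N - 1)) = cnj (mat_trace A)"
proof -
  obtain as where "char_poly A = (\<Prod>a \<leftarrow> as. [:- a, 1:])"
    using char_poly_factorized[OF A] by blast
  then obtain B where B: "B \<in> carrier_mat n n" and ut: "upper_triangular B" and "similar_mat A B"
    using schur_decomposition_exists[OF A] by blast
  then obtain P Q where wit: "similar_mat_wit A B P Q"
    by (auto simp: similar_mat_def)
  note w = similar_mat_witD2[OF A wit]
  \<comment> \<open>\<open>A\<close> is similar to the triangular \<open>B\<close>, so its powers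
    have the traces of the powers of \<open>B\<close>, which are power sums of the diagonal
    entries.\<close>
  have tr: "mat_trace (A ^\<^sub>m k) = (\<Sum>i<n. B $$ (i, i) ^ k)" for k
  proof -
    have c: "B ^\<^sub>m k \<in> carrier_mat n n" using B by (rule pow_carrier_mat)
    have "mat_trace (A ^\<^sub>m k) = mat_trace (P * (B ^\<^sub>m k * Q))"
      using similar_mat_wit_pow_id[OF wit, of k] w c by (simp add: assoc_mult_mat[of _ n n _ n _ n])
    also have "\<dots> = mat_trace (B ^\<^sub>m k * Q * P)"
      using w c by (intro mat_trace_mult_commute[of _ n n]) auto
    also have "B ^\<^sub>m k * Q * P = B ^\<^sub>m k"
      using w c by (simp add: assoc_mult_mat[of _ n n _ n _ n])
    also have "mat_trace (B ^\<^sub>m k) = (\<Sum>i<n. B $$ (i, i) ^ k)"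
      using c B upper_triangular_pow(2)[OF B ut] by (simp add: mat_trace_def)
    finally show ?thesis .
  qed
  \<comment> \<open>The \<open>N\<close>-th power of \<open>B\<close> is similar to the identity,
    hence equal to it. So each diagonal entry has \<open>N\<close>-th power 1 and norm 1, and both
    its power \<open>N - 1\<close> and its conjugate are its inverse.\<close>
  have root: "B $$ (i, i) ^ (N - 1) = cnj (B $$ (i, i))" if i: "i < n" for i
  proof -
    have "B ^\<^sub>m N = Q * A ^\<^sub>m N * P"
      by (rule similar_mat_wit_pow_id[OF similar_mat_wit_sym[OF wit]])
    also have "\<dots> = 1\<^sub>m n" using w(2,6,7) by (simp add: one)
    finally have b: "B $$ (i, i) ^ N = 1"
      using upper_triangular_pow(2)[OF B ut i, of N] i by simp
    then have "norm (B $$ (i, i)) ^ N = 1"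
      by (metis norm_one norm_power)
    then have "norm (B $$ (i, i)) = 1"
      using N power_eq_imp_eq_base[of "norm (B $$ (i, i))" N 1] by simp
    then have "B $$ (i, i) * cnj (B $$ (i, i)) = 1"
      using complex_norm_square[of "B $$ (i, i)"] by simp
    moreover have "B $$ (i, i) * B $$ (i, i) ^ (N - 1) = 1"
      using b N by (cases N) auto
    ultimately show ?thesis
      by (metis mult_cancel_left mult_zero_left zero_neq_one)
  qed
  have "mat_trace A = (\<Sum>i<n. B $$ (i, i))"
    using tr[of 1] A by simp
  then show ?thesis
    using tr[of "N - 1"] by (simp add: root del: One_nat_def)
qed

text \<open>With \<open>N\<close> the order of the group, the \<open>N\<close>-th power of
  \<open>\<rho> g\<close> is the identity matrix and the power \<open>N - 1\<close> of
  \<open>g\<close> is its inverse, so \<open>mat_trace_pow_pred\<close> applies.\<close>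

lemma cnj_mat_trace_representation:
  assumes G: "group G" and fin: "finite (carrier G)"
    and \<rho>: "complex_representation G n \<rho>" and g: "g \<in> carrier G"
  shows "cnj (mat_trace (\<rho> g)) = mat_trace (\<rho> (inv\<^bsub>G\<^esub> g))"
proof -
  interpret group G by fact
  note R = complex_representationD[OF G \<rho>]
  have pow: "\<rho> (g [^]\<^bsub>G\<^esub> (k :: nat)) = \<rho> g ^\<^sub>m k" for k
  proof (induction k)
    case 0
    then show ?case using R(1)[OF g] R(3) by simp
  next
    case (Suc k)
    then show ?case using R(2)[OF nat_pow_closed[OF g, of k] g] by simp
  qed
  let ?N = "Coset.order G"
  have N: "?N > 0" using fin by (simp add: order_gt_0_iff_finite)
  have one: "g [^]\<^bsub>G\<^esub> ?N = \<one>\<^bsub>G\<^esub>" using g by (rule pow_order_eq_1)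
  have "g [^]\<^bsub>G\<^esub> (?N - 1) \<otimes>\<^bsub>G\<^esub> g = \<one>\<^bsub>G\<^esub>"
    using one N by (cases ?N) auto
  then have "inv\<^bsub>G\<^esub> g = g [^]\<^bsub>G\<^esub> (?N - 1)"
    using g by (intro inv_equality) auto
  then show ?thesis
    using mat_trace_pow_pred[OF R(1)[OF g] N] pow[of ?N] pow[of "?N - 1"] one R(3) by simp
qed

text \<open>Inversion and transposition each reverse products, so together they preserve
  them.\<close>

lemma dual_representation:
  assumes G: "group G" and \<rho>: "complex_representation G n \<rho>"
  shows "complex_representation G n (\<lambda>g. transpose_mat (\<rho> (inv\<^bsub>G\<^esub> g)))"
proof -
  interpret group G by fact
  note R = complex_representationD[OF G \<rho>]
  show ?thesis
  proof (rule complex_representationI[OF G])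
    fix g h assume gh: "g \<in> carrier G" "h \<in> carrier G"
    then show "transpose_mat (\<rho> (inv\<^bsub>G\<^esub> (g \<otimes>\<^bsub>G\<^esub> h)))
        = transpose_mat (\<rho> (inv\<^bsub>G\<^esub> g)) * transpose_mat (\<rho> (inv\<^bsub>G\<^esub> h))"
      using R(1)[of "inv\<^bsub>G\<^esub> g"] R(1)[of "inv\<^bsub>G\<^esub> h"] R(2)[of "inv\<^bsub>G\<^esub> h" "inv\<^bsub>G\<^esub> g"]
      by (simp add: inv_mult_group transpose_mult[of _ n n _ n])
  qed (use R in auto)
qed

text \<open>The recursion uses only sums, differences and products of values of the character, all
  of which commute with conjugation.\<close>

lemma cnj_frobenius_char: "cnj (frobenius_char G \<phi> gs) = frobenius_char G (\<lambda>g. cnj (\<phi> g)) gs"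
  by (induction G \<phi> gs rule: frobenius_char.induct) (simp_all add: Let_def)

subsection \<open>Orthogonality of Frobenius characters\<close>

lemma frobenius_char_eq_sum_permutations:
  assumes G: "group G" and \<rho>: "complex_representation G n \<rho>"
    and \<phi>: "\<And>g. g \<in> carrier G \<Longrightarrow> \<phi> g = mat_trace (\<rho> g)"
    and gs: "gs \<in> tuples (carrier G) r"
  shows "frobenius_char G \<phi> gs = (\<Sum>f \<in> tuples {..<n} r. \<Sum>p | p permutes {0..<r}.
    signof p * (\<Prod>k<r. \<rho> (gs ! k) $$ (f ! p k, f ! k)))"
proof -
  have "frobenius_char G \<phi> gs
      = (\<Sum>f \<in> tuples {..<n} r. det (mat r r (\<lambda>(k, l). \<rho> (gs ! k) $$ (f ! l, f ! k))))"
    using \<phi> gs by (rule frobenius_char_eq_sum_det[OF G \<rho>])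
  moreover have "det (mat r r (\<lambda>(k, l). \<rho> (gs ! k) $$ (f ! l, f ! k)))
      = (\<Sum>p | p permutes {0..<r}. signof p * (\<Prod>k<r. \<rho> (gs ! k) $$ (f ! p k, f ! k)))" for f
    by (subst det_def'[of _ r])
      (auto simp: atLeast0LessThan permutes_in_image intro!: sum.cong prod.cong)
  ultimately show ?thesis by simp
qed

text \<open>For fixed \<open>p\<close>, the sum over \<open>q\<close> is the Leibniz expansion of
  \<open>D\<close> with its rows permuted by \<open>p\<close>, that is
  \<open>signof p * det D\<close>. The second factor \<open>signof p\<close> cancels the sign, so
  all \<open>r!\<close> choices of \<open>p\<close> contribute the same.\<close>

lemma sum_signof_delta:
  assumes "length f = r"
  shows "(\<Sum>p | p permutes {0..<r}. \<Sum>q | q permutes {0..<r}.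
      signof p * signof q * (if \<forall>k<r. f ! p k = f ! q k then 1 else 0))
    = (if distinct f then fact r else 0 :: complex)"
proof -
  define D :: "complex mat" where "D = mat r r (\<lambda>(k, l). if f ! k = f ! l then 1 else 0)"
  have D: "D \<in> carrier_mat r r" by (simp add: D_def)
  have det_D: "det D = (if distinct f then 1 else 0)"
  proof (cases "distinct f")
    case True
    then have "D = 1\<^sub>m r"
      using assms by (intro eq_matI) (auto simp: D_def nth_eq_iff_index_eq)
    with True show ?thesis by simp
  next
    case False
    then obtain i j where "i < r" "j < r" "i \<noteq> j" "f ! i = f ! j"
      using assms by (auto simp: distinct_conv_nth)
    then have "det D = 0"
      by (intro det_identical_rows[OF D, of i j]) (auto simp: D_def)
    with False show ?thesis by simp
  qed
  have "(\<Sum>q | q permutes {0..<r}. signof p * signof q * (if \<forall>k<r. f ! p k = f ! q k then 1 else 0))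
      = det D" if p: "p permutes {0..<r}" for p
  proof -
    have "(\<Sum>q | q permutes {0..<r}. signof q * (if \<forall>k<r. f ! p k = f ! q k then 1 else 0))
        = det (mat r r (\<lambda>(k, l). D $$ (p k, l)))"
      unfolding det_def'[OF mat_carrier]
    proof (intro sum.cong refl)
      fix q assume "q \<in> {q. q permutes {0..<r}}"
      then have q: "q permutes {0..<r}" by simp
      have pq: "p k < r" "q k < r" if "k < r" for k
        using that permutes_in_image[OF p, of k] permutes_in_image[OF q, of k] by auto
      have "(\<Prod>k = 0..<r. mat r r (\<lambda>(k, l). D $$ (p k, l)) $$ (k, q k))
          = (\<Prod>k = 0..<r. if f ! p k = f ! q k then 1 else 0)"
        by (intro prod.cong refl) (auto simp: D_def pq)
      also have "\<dots> = (if \<forall>k<r. f ! p k = f ! q k then 1 else 0)"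
        by auto
      finally show "signof q * (if \<forall>k<r. f ! p k = f ! q k then 1 else 0)
          = signof q * (\<Prod>k = 0..<r. mat r r (\<lambda>(k, l). D $$ (p k, l)) $$ (k, q k))"
        by simp
    qed
    also have "\<dots> = signof p * det D"
      by (rule det_permute_rows[OF D p])
    finally show ?thesis
      by (simp add: mult.assoc sign_def flip: sum_distrib_left)
  qed
  then have "(\<Sum>p | p permutes {0..<r}. \<Sum>q | q permutes {0..<r}.
      signof p * signof q * (if \<forall>k<r. f ! p k = f ! q k then 1 else 0))
    = of_nat (card {p. p permutes {0..<r}}) * det D"
    by simp
  then show ?thesis
    by (simp add: det_D card_permutations[OF refl])
qed

text \<open>For \<open>r \<le> n\<close> this is the falling factorial. For \<open>r > n\<close>
  both sides are zero: no tuple is distinct, and the factor with \<open>k = n\<close>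
  vanishes.\<close>

lemma card_distinct_tuples:
  "of_nat (card {f \<in> tuples {..<n} r. distinct f}) = (\<Prod>k<r. of_nat n - of_nat k :: 'a :: comm_ring_1)"
proof (cases "r \<le> n")
  case True
  have "{f \<in> tuples {..<n} r. distinct f} = {f. length f = r \<and> distinct f \<and> set f \<subseteq> {..<n}}"
    by auto
  then have "card {f \<in> tuples {..<n} r. distinct f} = \<Prod>{n - r + 1..n}"
    using card_lists_distinct_length_eq[of "{..<n}" r] True by simp
  also have "\<dots> = (\<Prod>k<r. n - k)"
    using True by (intro prod.reindex_bij_witness[where i = "\<lambda>k. n - k" and j = "\<lambda>k. n - k"]) auto
  finally show ?thesis
    using True by (simp add: of_nat_diff)
next
  case False
  have "\<not> distinct f" if "f \<in> tuples {..<n} r" for f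
    using that False card_mono[of "{..<n}" "set f"] by (auto simp: distinct_card)
  then have none: "{f \<in> tuples {..<n} r. distinct f} = {}" by blast
  have "(\<Prod>k<r. of_nat n - of_nat k :: 'a) = 0"
    using False by (intro prod_zero) (auto intro!: bexI[of _ n])
  then show ?thesis by (simp only: none card.empty of_nat_0)
qed

text \<open>Both characters are expanded over permutations, the conjugated one through the dual
  representation. The transpose there is the reason why the indices of \<open>\<sigma>\<close>
  appear in the opposite order to those of \<open>\<rho>\<close>.\<close>

lemma sum_frobenius_char_product:
  assumes G: "group G" and fin: "finite (carrier G)"
    and \<rho>: "complex_representation G n \<rho>" and \<sigma>: "complex_representation G m \<sigma>"
    and \<phi>: "\<And>g. g \<in> carrier G \<Longrightarrow> \<phi> g = mat_trace (\<rho> g)"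
    and \<psi>: "\<And>g. g \<in> carrier G \<Longrightarrow> \<psi> g = mat_trace (\<sigma> g)"
  shows "(\<Sum>gs \<in> tuples (carrier G) r. frobenius_char G \<phi> gs * cnj (frobenius_char G \<psi> gs))
    = (\<Sum>f \<in> tuples {..<n} r. \<Sum>f' \<in> tuples {..<m} r.
        \<Sum>p | p permutes {0..<r}. \<Sum>q | q permutes {0..<r}. signof p * signof q *
          (\<Prod>k<r. \<Sum>g \<in> carrier G. \<rho> g $$ (f ! p k, f ! k) * \<sigma> (inv\<^bsub>G\<^esub> g) $$ (f' ! k, f' ! q k)))"
proof -
  interpret group G by fact
  let ?\<sigma> = "\<lambda>g. transpose_mat (\<sigma> (inv\<^bsub>G\<^esub> g))"
  let ?S = "tuples (carrier G) r" and ?I = "tuples {..<n} r" and ?J = "tuples {..<m} r"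
  let ?P = "{p. p permutes {0..<r}}"
  have \<sigma>c: "\<sigma> (inv\<^bsub>G\<^esub> g) \<in> carrier_mat m m" if "g \<in> carrier G" for g
    using that complex_representationD(1)[OF G \<sigma>] by simp
  have tr: "cnj (\<psi> g) = mat_trace (?\<sigma> g)" if "g \<in> carrier G" for g
    using cnj_mat_trace_representation[OF G fin \<sigma> that] \<psi>[OF that] \<sigma>c[OF that]
    by (simp add: mat_trace_def)
  have "(\<Sum>gs \<in> ?S. frobenius_char G \<phi> gs * cnj (frobenius_char G \<psi> gs))
      = (\<Sum>gs \<in> ?S. \<Sum>f \<in> ?I. \<Sum>f' \<in> ?J. \<Sum>p \<in> ?P. \<Sum>q \<in> ?P. signof p * signof q *
          (\<Prod>k<r. \<rho> (gs ! k) $$ (f ! p k, f ! k) * \<sigma> (inv\<^bsub>G\<^esub> (gs ! k)) $$ (f' ! k, f' ! q k)))"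
  proof (intro sum.cong refl)
    fix gs assume gs: "gs \<in> ?S"
    have "frobenius_char G \<phi> gs * cnj (frobenius_char G \<psi> gs)
      = (\<Sum>f \<in> ?I. \<Sum>p \<in> ?P. signof p * (\<Prod>k<r. \<rho> (gs ! k) $$ (f ! p k, f ! k)))
        * (\<Sum>f' \<in> ?J. \<Sum>q \<in> ?P. signof q * (\<Prod>k<r. ?\<sigma> (gs ! k) $$ (f' ! q k, f' ! k)))"
      unfolding cnj_frobenius_char
      using \<phi> tr gs by (intro arg_cong2[of _ _ _ _ "(*)"]
          frobenius_char_eq_sum_permutations[OF G \<rho>]
          frobenius_char_eq_sum_permutations[OF G dual_representation[OF G \<sigma>]]) blast+
    also have "\<dots> = (\<Sum>f \<in> ?I. \<Sum>f' \<in> ?J. \<Sum>p \<in> ?P. \<Sum>q \<in> ?P. signof p * signof q *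
        (\<Prod>k<r. \<rho> (gs ! k) $$ (f ! p k, f ! k) * ?\<sigma> (gs ! k) $$ (f' ! q k, f' ! k)))"
      by (simp only: sum_product prod.distrib mult_ac)
    also have "\<dots> = (\<Sum>f \<in> ?I. \<Sum>f' \<in> ?J. \<Sum>p \<in> ?P. \<Sum>q \<in> ?P. signof p * signof q *
        (\<Prod>k<r. \<rho> (gs ! k) $$ (f ! p k, f ! k) * \<sigma> (inv\<^bsub>G\<^esub> (gs ! k)) $$ (f' ! k, f' ! q k)))"
    proof (intro sum.cong prod.cong refl arg_cong2[of _ _ _ _ "(*)"])
      fix f' q k assume f': "f' \<in> ?J" and q: "q \<in> ?P" and k: "k \<in> {..<r}"
      have "q k < r" using k q permutes_in_image[of q "{0..<r}" k] by auto
      then have "f' ! q k < m" "f' ! k < m" using f' k nth_mem by fastforce+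
      moreover have "gs ! k \<in> carrier G" using gs k nth_mem by fastforce
      ultimately show "?\<sigma> (gs ! k) $$ (f' ! q k, f' ! k) = \<sigma> (inv\<^bsub>G\<^esub> (gs ! k)) $$ (f' ! k, f' ! q k)"
        using \<sigma>c[of "gs ! k"] by simp
    qed
    finally show "frobenius_char G \<phi> gs * cnj (frobenius_char G \<psi> gs) = \<dots>" .
  qed
  also have "\<dots> = (\<Sum>f \<in> ?I. \<Sum>f' \<in> ?J. \<Sum>p \<in> ?P. \<Sum>q \<in> ?P. \<Sum>gs \<in> ?S. signof p * signof q *
          (\<Prod>k<r. \<rho> (gs ! k) $$ (f ! p k, f ! k) * \<sigma> (inv\<^bsub>G\<^esub> (gs ! k)) $$ (f' ! k, f' ! q k)))"
    \<comment> \<open>The sum over group tuples moves innermost, where it meets a product over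
      coordinates and factors.\<close>
    by (simp only: sum.swap[of _ _ ?S])
  also have "\<dots> = (\<Sum>f \<in> ?I. \<Sum>f' \<in> ?J. \<Sum>p \<in> ?P. \<Sum>q \<in> ?P. signof p * signof q *
          (\<Prod>k<r. \<Sum>g \<in> carrier G. \<rho> g $$ (f ! p k, f ! k) * \<sigma> (inv\<^bsub>G\<^esub> g) $$ (f' ! k, f' ! q k)))"
  proof (intro sum.cong refl)
    fix f f' p q
    show "(\<Sum>gs \<in> ?S. signof p * signof q *
          (\<Prod>k<r. \<rho> (gs ! k) $$ (f ! p k, f ! k) * \<sigma> (inv\<^bsub>G\<^esub> (gs ! k)) $$ (f' ! k, f' ! q k)))
      = signof p * signof q *
          (\<Prod>k<r. \<Sum>g \<in> carrier G. \<rho> g $$ (f ! p k, f ! k) * \<sigma> (inv\<^bsub>G\<^esub> g) $$ (f' ! k, f' ! q k))"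
      unfolding sum_prod_tuples[symmetric] by (rule sum_distrib_left[symmetric])
  qed
  finally show ?thesis .
qed

theorem theorem2p1:
  fixes G :: "('g, 'm) monoid_scheme"
    and X :: "nat \<Rightarrow> 'g \<Rightarrow> complex"
    and t i j r :: nat
  assumes "group G"
    and "finite (carrier G)"
    and "bij_betw X {1..t} (irreducible_characters G)"
    and "i \<in> {1..t}" and "j \<in> {1..t}"
    and "r \<ge> 1"
  shows "(\<Sum>gs \<in> group_tuples G r. frobenius_char G (X i) gs * cnj (frobenius_char G (X j) gs)) =
         (fact r * of_nat (card (carrier G)) ^ r * (if i = j then 1 else 0)) / char_dim G (X i) ^ (r - 1)
         * (\<Prod>k = 1..r - 1. char_dim G (X i) - of_nat k)"
proof -
  interpret group G by fact
  note G = \<open>group G\<close> and fin = \<open>finite (carrier G)\<close>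
  have Xirr: "X l \<in> irreducible_characters G" if "l \<in> {1..t}" for l
    using assms(3) that by (auto simp: bij_betw_def)
  obtain n \<rho> where \<rho>: "irreducible_representation G n \<rho>"
    and Xi: "X i = (\<lambda>g \<in> carrier G. mat_trace (\<rho> g))"
    using Xirr[OF assms(4)] by (auto simp: irreducible_characters_def)
  have \<rho>': "complex_representation G n \<rho>" and n: "n > 0"
    using \<rho> by (auto simp: irreducible_representation_def)
  have perm_lt: "p k < r" if "p permutes {0..<r}" "k < r" for p k
    using that permutes_in_image[of p "{0..<r}" k] by auto
  have nth_lt: "f ! k < d" if "f \<in> tuples {..<d} r" "k < r" for f k d
    using that nth_mem by fastforce
  show ?thesis
  proof (cases "i = j")
    case False
    obtain m \<sigma> where \<sigma>: "irreducible_representation G m \<sigma>"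
      and Xj: "X j = (\<lambda>g \<in> carrier G. mat_trace (\<sigma> g))"
      using Xirr[OF assms(5)] by (auto simp: irreducible_characters_def)
    have \<sigma>': "complex_representation G m \<sigma>"
      using \<sigma> by (auto simp: irreducible_representation_def)
    have "X i \<noteq> X j"
      using inj_onD[OF bij_betw_imp_inj_on[OF assms(3)] _ assms(4,5)] False by blast
    \<comment> \<open>Characters are restricted to the carrier, so distinct ones differ at an
      element of the group.\<close>
    then obtain g where g: "g \<in> carrier G" "mat_trace (\<rho> g) \<noteq> mat_trace (\<sigma> g)"
      unfolding Xi Xj by (metis restrict_ext)
    have "(\<Prod>k<r. \<Sum>g \<in> carrier G. \<rho> g $$ (f ! p k, f ! k) * \<sigma> (inv\<^bsub>G\<^esub> g) $$ (f' ! k, f' ! q k)) = 0"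
      if "f \<in> tuples {..<n} r" "f' \<in> tuples {..<m} r" "p permutes {0..<r}" "q permutes {0..<r}" for f f' p q
    proof -
      \<comment> \<open>A single vanishing factor suffices, and \<open>r \<ge> 1\<close> provides
        the one at index 0.\<close>
      have "0 < r" using assms(6) by simp
      then have "(\<Sum>g \<in> carrier G. \<rho> g $$ (f ! p 0, f ! 0) * \<sigma> (inv\<^bsub>G\<^esub> g) $$ (f' ! 0, f' ! q 0)) = 0"
        using that by (intro schur_orthogonality_distinct[OF G \<rho> \<sigma> g] nth_lt[OF that(1)]
            nth_lt[OF that(2)] perm_lt[OF that(3)] perm_lt[OF that(4)])
      then show ?thesis
        using \<open>0 < r\<close> by (intro prod_zero) auto
    qed
    then show ?thesis
      using False unfolding group_tuples_def
      by (subst sum_frobenius_char_product[OF G fin \<rho>' \<sigma>'])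
        (auto simp: Xi Xj intro!: sum.neutral)
  next
    case True
    define c :: complex where "c = of_nat (card (carrier G)) / of_nat n"
    \<comment> \<open>By orthogonality each factor is \<open>c\<close> or 0. The conditions
      \<open>f ! k = f' ! k\<close> force \<open>f' = f\<close>; what remains is that
      \<open>f\<close> composed with \<open>p\<close> agrees with \<open>f\<close> composed with
      \<open>q\<close>.\<close>
    have prod: "(\<Prod>k<r. \<Sum>g \<in> carrier G. \<rho> g $$ (f ! p k, f ! k) * \<rho> (inv\<^bsub>G\<^esub> g) $$ (f' ! k, f' ! q k))
        = (if f' = f then c ^ r * (if \<forall>k<r. f ! p k = f ! q k then 1 else 0) else 0)"
      if f: "f \<in> tuples {..<n} r" and f': "f' \<in> tuples {..<n} r"
        and p: "p permutes {0..<r}" and q: "q permutes {0..<r}" for f f' p q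
    proof -
      have "(\<Prod>k<r. \<Sum>g \<in> carrier G. \<rho> g $$ (f ! p k, f ! k) * \<rho> (inv\<^bsub>G\<^esub> g) $$ (f' ! k, f' ! q k))
          = (\<Prod>k<r. if f ! p k = f' ! q k \<and> f ! k = f' ! k then c else 0)"
        unfolding c_def
        by (intro prod.cong refl schur_orthogonality_same[OF G \<rho>] nth_lt[OF f] nth_lt[OF f'] perm_lt[OF p] perm_lt[OF q]) auto
      also have "\<dots> = (if \<forall>k<r. f ! p k = f' ! q k \<and> f ! k = f' ! k then c ^ r else 0)"
        by (auto intro!: prod_zero)
      also have "(\<forall>k<r. f ! p k = f' ! q k \<and> f ! k = f' ! k) \<longleftrightarrow> f' = f \<and> (\<forall>k<r. f ! p k = f ! q k)"
      proof -
        have "(\<forall>k<r. f ! k = f' ! k) \<longleftrightarrow> f' = f"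
          using f f' by (auto intro: nth_equalityI)
        then show ?thesis by blast
      qed
      also have "(if f' = f \<and> Q then c ^ r else 0) = (if f' = f then c ^ r * (if Q then 1 else 0) else 0)" for Q
        by simp
      finally show ?thesis .
    qed
    let ?I = "tuples {..<n} r" and ?P = "{p. p permutes {0..<r}}"
    have fin_I: "finite ?I" using finite_lists_length_eq[of "{..<n}" r] by simp
    have "(\<Sum>gs \<in> group_tuples G r. frobenius_char G (X i) gs * cnj (frobenius_char G (X i) gs))
      = (\<Sum>f \<in> ?I. \<Sum>f' \<in> ?I. \<Sum>p \<in> ?P. \<Sum>q \<in> ?P. signof p * signof q *
          (if f' = f then c ^ r * (if \<forall>k<r. f ! p k = f ! q k then 1 else 0) else 0))"
      unfolding group_tuples_def
      by (subst sum_frobenius_char_product[OF G fin \<rho>' \<rho>'])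
        (auto simp: Xi prod intro!: sum.cong)
    also have "\<dots> = (\<Sum>f \<in> ?I. \<Sum>f' \<in> ?I. if f' = f then c ^ r * (\<Sum>p \<in> ?P. \<Sum>q \<in> ?P. signof p * signof q *
          (if \<forall>k<r. f ! p k = f ! q k then 1 else 0)) else 0)"
      by (intro sum.cong refl) (auto simp: sum_distrib_left mult_ac intro!: sum.cong)
    also have "\<dots> = (\<Sum>f \<in> ?I. c ^ r * (if distinct f then fact r else 0))"
      using fin_I by (intro sum.cong refl) (simp only: sum.delta, simp add: sum_signof_delta)
    also have "\<dots> = c ^ r * (fact r * of_nat (card {f \<in> ?I. distinct f}))"
      using fin_I by (simp add: sum_distrib_left[symmetric] sum.If_cases Int_def)
    also have "\<dots> = c ^ r * fact r * (\<Prod>k<r. of_nat n - of_nat k)"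
      by (simp only: card_distinct_tuples mult.assoc)
    \<comment> \<open>The factor for \<open>k = 0\<close> is split off: it cancels one of the
      \<open>r\<close> powers of \<open>n\<close> in the denominator of \<open>c ^ r\<close>, which
      leaves the exponent \<open>r - 1\<close>.\<close>
    also have "(\<Prod>k<r. of_nat n - of_nat k :: complex) = of_nat n * (\<Prod>k = 1..r - 1. of_nat n - of_nat k)"
    proof -
      have "{..<r} = insert 0 {1..r - 1}" using assms(6) by auto
      then show ?thesis by simp
    qed
    also have "c ^ r * fact r * (of_nat n * (\<Prod>k = 1..r - 1. of_nat n - of_nat k))
        = fact r * of_nat (card (carrier G)) ^ r / of_nat n ^ (r - 1) * (\<Prod>k = 1..r - 1. of_nat n - of_nat k)"
      using n assms(6) by (cases r) (simp_all add: c_def field_simps)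
    also have "(of_nat n :: complex) = char_dim G (X i)"
      using complex_representationD(3)[OF G \<rho>'] by (simp add: char_dim_def Xi mat_trace_def)
    finally show ?thesis using True by simp
  qed
qed

end
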